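(* Coherence is not equivalent to its instances for sequences of length $4$. That is, it is not the case that every finite social decision frame $(W,\mathcal{M})$ is coherent if and only if every sequence $A_1,A_2,A_3,A_4$ of subsets of $W$ that satisfies (c1) and (c2) (with $n=4$) also satisfies (c3) and (c4).
   Context: A finite social decision frame is a pair $(W,\mathcal{M})$ where $W$ is a nonempty finite set and $\mathcal{M}$ is a family of subsets of $W$. Put $A^c=W\setminus A$ and $\mathcal{H}=\{A\subseteq W: A\notin\mathcal{M}\text{ and }A^c\notin\mathcal{M}\}$. For a sequence $A_1,\dots,A_n$ of subsets of $W$ (repetitions allowed, $n\ge1$), consider the conditions: (c1) $A_i\in\mathcal{M}\cup\mathcal{H}$ for all $i$; (c2) every $w\in W$ satisfies $|\{i\le n: w\in A_i\}|\le n/2$; (c3) $A_i\in\mathcal{H}$ for all $i$; (c4) every $w\in W$ satisfies $|\{i\le n: w\in A_i\}|= n/2$. The frame is coherent if for every $n\ge 1$, every sequence of length $n$ that satisfies (c1) and (c2) also satisfies (c3) and (c4). *)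

theory Defs
  imports Complex_Main
begin

definition social_decision_frame :: "'a set \<Rightarrow> 'a set set \<Rightarrow> bool" where
  "social_decision_frame W M \<longleftrightarrow> finite W \<and> W \<noteq> {} \<and> M \<subseteq> Pow W"

definition half_sets :: "'a set \<Rightarrow> 'a set set \<Rightarrow> 'a set set" where
  "half_sets W M = {A. A \<subseteq> W \<and> A \<notin> M \<and> W - A \<notin> M}"

text \<open>A sequence of length \<open>n\<close> is a function \<open>A\<close> on \<open>nat\<close> of which only the
  values at \<open>1, \<dots>, n\<close> are ever used.\<close>

definition subset_seq :: "'a set \<Rightarrow> nat \<Rightarrow> (nat \<Rightarrow> 'a set) \<Rightarrow> bool" where
  "subset_seq W n A \<longleftrightarrow> (\<forall>i\<in>{1..n}. A i \<subseteq> W)"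

definition occurrences :: "nat \<Rightarrow> (nat \<Rightarrow> 'a set) \<Rightarrow> 'a \<Rightarrow> nat" where
  "occurrences n A w = card {i \<in> {1..n}. w \<in> A i}"

definition c1 :: "'a set \<Rightarrow> 'a set set \<Rightarrow> nat \<Rightarrow> (nat \<Rightarrow> 'a set) \<Rightarrow> bool" where
  "c1 W M n A \<longleftrightarrow> (\<forall>i\<in>{1..n}. A i \<in> M \<union> half_sets W M)"

definition c2 :: "'a set \<Rightarrow> nat \<Rightarrow> (nat \<Rightarrow> 'a set) \<Rightarrow> bool" where
  "c2 W n A \<longleftrightarrow> (\<forall>w\<in>W. real (occurrences n A w) \<le> real n / 2)"

definition c3 :: "'a set \<Rightarrow> 'a set set \<Rightarrow> nat \<Rightarrow> (nat \<Rightarrow> 'a set) \<Rightarrow> bool" where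
  "c3 W M n A \<longleftrightarrow> (\<forall>i\<in>{1..n}. A i \<in> half_sets W M)"

definition c4 :: "'a set \<Rightarrow> nat \<Rightarrow> (nat \<Rightarrow> 'a set) \<Rightarrow> bool" where
  "c4 W n A \<longleftrightarrow> (\<forall>w\<in>W. real (occurrences n A w) = real n / 2)"

definition coherent_at :: "nat \<Rightarrow> 'a set \<Rightarrow> 'a set set \<Rightarrow> bool" where
  "coherent_at n W M \<longleftrightarrow>
     (\<forall>A. subset_seq W n A \<and> c1 W M n A \<and> c2 W n A \<longrightarrow> c3 W M n A \<and> c4 W n A)"

definition coherent :: "'a set \<Rightarrow> 'a set set \<Rightarrow> bool" where
  "coherent W M \<longleftrightarrow> (\<forall>n\<ge>1. coherent_at n W M)"

end

(* Give the ten voters 0, ..., 9 the weights below (total 80), let a set of weight more than 40 be a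
   majority, and let a tie of weight 40 be a majority iff it contains a multiple of three of the
   voters 0, ..., 4. Of two complementary ties exactly one is then a majority. In a sequence of
   four majorities where every voter occurs at most twice, all sets must be ties and every voter
   must occur exactly twice; counting the occurrences of 0, ..., 4 gives 3 dvd 10. But there are
   six tied majorities in which every voter occurs exactly three times, consistently with
   3 dvd 15. *)

theory Submission
  imports Defs
begin

text \<open>Double counting of the pairs (i, w) with w in \<open>A i\<close>, each weighted by
  \<open>g w\<close>; used for both \<open>weight\<close> and \<open>low\<close>.\<close>

lemma sum_occurrences:
  fixes g :: "'a \<Rightarrow> nat"
  assumes "finite W" and "subset_seq W n A"
  shows "(\<Sum>i=1..n. sum g (A i)) = (\<Sum>w\<in>W. g w * occurrences n A w)"
proof -
  have "(\<Sum>i=1..n. sum g (A i)) = (\<Sum>i=1..n. \<Sum>w\<in>W. g w * of_bool (w \<in> A i))"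
  proof (rule sum.cong[OF refl])
    fix i assume "i \<in> {1..n}"
    then have "A i \<subseteq> W"
      using assms(2) by (simp add: subset_seq_def)
    then show "sum g (A i) = (\<Sum>w\<in>W. g w * of_bool (w \<in> A i))"
      by (intro sum.mono_neutral_cong_left assms(1)) auto
  qed
  also have "\<dots> = (\<Sum>w\<in>W. \<Sum>i=1..n. g w * of_bool (w \<in> A i))"
    by (rule sum.swap)
  also have "\<dots> = (\<Sum>w\<in>W. g w * occurrences n A w)"
    by (simp add: occurrences_def sum_distrib_left[symmetric] Int_def)
  finally show ?thesis .
qed

definition voters :: "nat set" where
  "voters = {..<10}"

definition weight :: "nat \<Rightarrow> nat" where
  "weight w = [7, 11, 3, 6, 13, 12, 5, 5, 4, 14] ! w"

definition low :: "nat \<Rightarrow> nat" where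
  "low w = of_bool (w < 5)"

definition majorities :: "nat set set" where
  "majorities = {A. A \<subseteq> voters \<and>
     (40 < sum weight A \<or> sum weight A = 40 \<and> 3 dvd sum low A)}"

lemma voters_eq: "voters = {0, 1, 2, 3, 4, 5, 6, 7, 8, 9}"
  by (auto simp: voters_def)

lemma finite_voters: "finite voters"
  by (simp add: voters_def)

lemma sum_voters: "sum weight voters = 80" "sum low voters = 5"
  by (simp_all add: voters_eq weight_def low_def)

lemma weight_pos: "w \<in> voters \<Longrightarrow> 0 < weight w"
  by (auto simp: voters_eq weight_def)

lemma sum_Diff_voters:
  fixes g :: "nat \<Rightarrow> nat"
  assumes "A \<subseteq> voters"
  shows "sum g A + sum g (voters - A) = sum g voters"
  using sum.subset_diff[OF assms finite_voters, of g] by simp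

text \<open>If a tie contained four low voters, its remaining members would weigh as much as the
  missing low voter, but 7, 11, 3, 6, 13 are not subset sums of 12, 5, 5, 4, 14.\<close>

lemma tie_low:
  assumes "A \<subseteq> voters" and "sum weight A = 40"
  shows "3 dvd sum low A \<or> 3 dvd sum low (voters - A)"
proof -
  have expand: "sum g A = (\<Sum>w\<in>voters. if w \<in> A then g w else 0)" for g :: "nat \<Rightarrow> nat"
    using assms(1) by (simp add: sum.inter_restrict[symmetric] finite_voters Int_absorb1)
  \<comment> \<open>A splitting of the 5 low voters avoids multiples of 3 only as 1 + 4.\<close>
  have "sum low A \<noteq> 1 \<and> sum low A \<noteq> 4"
    using assms(2) unfolding expand
    by (simp add: voters_eq weight_def low_def split: if_splits)
  moreover have "sum low A + sum low (voters - A) = 5"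
    using sum_Diff_voters[OF assms(1), of low] by (simp add: sum_voters)
  ultimately show ?thesis
    by presburger
qed

text \<open>Complementary sets weigh 80 together: one exceeds 40, or both are ties and
  \<open>tie_low\<close> decides. Hence (c3) always fails, and coherence at n \<ge> 1 means that no
  sequence satisfies (c1) and (c2).\<close>

lemma half_sets_majorities: "half_sets voters majorities = {}"
proof -
  have "A \<in> majorities \<or> voters - A \<in> majorities" if "A \<subseteq> voters" for A
    using sum_Diff_voters[OF that, of weight] tie_low[OF that] that
    by (auto simp: majorities_def sum_voters)
  then show ?thesis
    by (auto simp: half_sets_def)
qed

lemma coherent_at_4_majorities: "coherent_at 4 voters majorities"
proof -
  have False if seq: "subset_seq voters 4 A" and "c1 voters majorities 4 A" and "c2 voters 4 A" for A
  proof -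
    have maj: "A i \<in> majorities" if "i \<in> {1..4}" for i
      using \<open>c1 voters majorities 4 A\<close> that by (simp add: c1_def half_sets_majorities)
    have occ: "occurrences 4 A w \<le> 2" if "w \<in> voters" for w
      using \<open>c2 voters 4 A\<close> that by (auto simp: c2_def)
    have ge: "40 \<le> sum weight (A i)" if "i \<in> {1..4}" for i
      using maj[OF that] by (auto simp: majorities_def)
    \<comment> \<open>The bounds 4 * 40 and 2 * 80 agree, so the total weight is squeezed; as
      weights are positive, any strict inequality for a set or a voter is contradictory.\<close>
    have lower: "(\<Sum>i=1..4::nat. 40) \<le> (\<Sum>i=1..4. sum weight (A i))"
      by (intro sum_mono ge)
    have upper: "(\<Sum>w\<in>voters. weight w * occurrences 4 A w) \<le> (\<Sum>w\<in>voters. weight w * 2)"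
      by (intro sum_mono mult_le_mono2 occ)
    have total: "(\<Sum>w\<in>voters. weight w * 2) = 160"
      by (simp add: sum_distrib_right[symmetric] sum_voters)
    have eq: "sum weight (A i) = 40" if "i \<in> {1..4}" for i
    proof (rule ccontr)
      assume "sum weight (A i) \<noteq> 40"
      then have "40 < sum weight (A i)"
        using ge[OF that] by simp
      then have "(\<Sum>i=1..4::nat. 40) < (\<Sum>i=1..4. sum weight (A i))"
        using that ge by (intro sum_strict_mono_ex1) auto
      then show False
        using upper total sum_occurrences[OF finite_voters seq, of weight] by simp
    qed
    have occ2: "occurrences 4 A w = 2" if "w \<in> voters" for w
    proof (rule ccontr)
      assume "occurrences 4 A w \<noteq> 2"
      then have "weight w * occurrences 4 A w < weight w * 2"
        using occ[OF that] weight_pos[OF that] by simp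
      then have "(\<Sum>w\<in>voters. weight w * occurrences 4 A w) < (\<Sum>w\<in>voters. weight w * 2)"
        using that by (intro sum_strict_mono_ex1 finite_voters) (auto intro: occ)
      then show False
        using lower total sum_occurrences[OF finite_voters seq, of weight] by simp
    qed
    have "3 dvd sum low (A i)" if "i \<in> {1..4}" for i
      using maj[OF that] eq[OF that] by (simp add: majorities_def)
    then have "3 dvd (\<Sum>i=1..4. sum low (A i))"
      by (rule dvd_sum)
    also have "(\<Sum>i=1..4. sum low (A i)) = (\<Sum>w\<in>voters. low w * 2)"
      using sum_occurrences[OF finite_voters seq, of low] by (simp add: occ2)
    also have "\<dots> = 10"
      by (simp add: sum_distrib_right[symmetric] sum_voters)
    finally show False
      by simp
  qed
  then show ?thesis
    by (auto simp: coherent_at_def)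
qed

text \<open>The first five sets have three low voters each and contain every other voter twice; the
  last set supplies the third occurrence of those others.\<close>

definition balanced_ties :: "nat \<Rightarrow> nat set" where
  "balanced_ties i =
     [{0, 1, 3, 5, 8}, {0, 1, 2, 6, 9}, {0, 2, 4, 5, 7},
      {1, 3, 4, 6, 7}, {2, 3, 4, 8, 9}, {5, 6, 7, 8, 9}] ! (i - 1)"

lemma atLeastAtMost_1_6: "{1..6::nat} = {1, 2, 3, 4, 5, 6}"
  by auto

lemma balanced_ties_majorities: "i \<in> {1..6} \<Longrightarrow> balanced_ties i \<in> majorities"
  unfolding atLeastAtMost_1_6
  by (auto simp: balanced_ties_def majorities_def voters_eq weight_def low_def) presburger+

lemma occurrences_balanced_ties:
  assumes "w \<in> voters"
  shows "occurrences 6 balanced_ties w = 3"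
proof -
  have "occurrences 6 balanced_ties w = (\<Sum>i=1..6. of_bool (w \<in> balanced_ties i))"
    by (simp add: occurrences_def Int_def)
  also have "\<dots> = 3"
    using assms unfolding atLeastAtMost_1_6 voters_eq
    by (auto simp: balanced_ties_def)
  finally show ?thesis .
qed

lemma not_coherent_majorities: "\<not> coherent voters majorities"
proof
  assume "coherent voters majorities"
  then have "coherent_at 6 voters majorities"
    by (simp add: coherent_def)
  moreover have "subset_seq voters 6 balanced_ties" "c1 voters majorities 6 balanced_ties"
    using balanced_ties_majorities by (auto simp: subset_seq_def c1_def majorities_def)
  moreover have "c2 voters 6 balanced_ties"
    by (simp add: c2_def occurrences_balanced_ties)
  ultimately have "c3 voters majorities 6 balanced_ties"
    unfolding coherent_at_def by blast
  then have "balanced_ties 1 \<in> half_sets voters majorities"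
    unfolding c3_def by (rule bspec) simp
  then show False
    by (simp add: half_sets_majorities)
qed

(* A free type variable would be quantified outside the negation, claiming a counterexample
   inside every type, even a one-element one. Every finite frame is isomorphic to one whose
   points are natural numbers, so nat loses no frames. *)
theorem mainTheorem7:
  shows "\<not> (\<forall>(W :: nat set) (M :: nat set set).
            social_decision_frame W M \<longrightarrow> (coherent W M \<longleftrightarrow> coherent_at 4 W M))"
proof -
  have "social_decision_frame voters majorities"
    by (auto simp: social_decision_frame_def voters_eq majorities_def)
  then show ?thesis
    using coherent_at_4_majorities not_coherent_majorities by blast
qed

end
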